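(* Let $K$ be a commutative, infinite idempotent semifield and let $p \in K[X]$ be a polynomial of degree $n > 0$. Then the following conditions are equivalent: (1) $p$ is closable; (2) the polynomial function $\widehat{p}$ splits in $K$. In this case, $\widehat{p}(x) = p_n (x + c_1) \cdots (x + c_n)$ for all $x \in K$, where $c_1 \geqslant \cdots \geqslant c_n$ are the corners of the closure $\overline{p}$, and for all $0 \leqslant j < n$ the infimum $\overline{p}_j$ of $\{ \widehat{p}(x) x^{-j} : x \in K^* \}$ is reached at $c_{n-j}$, in the sense that $\overline{p}_j^{\,j+1} = \widehat{p}(c_{n-j})\, \overline{p}_{j+1}^{\,j}$ (which, when $c_{n-j}\neq 0$, says exactly that $\overline{p}_j=\widehat p(c_{n-j})c_{n-j}^{-j}$).
   Context: A semiring is a commutative monoid $(S,+,0)$ with an associative multiplication having identity $1$, distributing over $+$, and with $0$ absorbing. A semifield is a semiring with $1\neq 0$ in which every nonzero element has a multiplicative inverse; it is idempotent if $x+x=x$ for all $x$. All idempotent semifields are assumed commutative and infinite. An idempotent semifield $K$ is ordered by $x\leqslant y \iff x+y=y$; then $0$ is the least element and $x+y$ is the supremum of $\{x,y\}$. $K^*=K\setminus\{0\}$, $\mathbb{N}$ contains $0$, and $x^0=1$ for all $x\in K$. A polynomial $p\in K[X]$ is a formal polynomial $p=\sum_{j\in\mathbb{N}}p_jX^j$ (eventually zero sequence of coefficients, coefficientwise addition, Cauchy product). Its polynomial function is $\widehat p:K\to K$, $\widehat p(x)=\sum_j p_jx^j$; different formal polynomials may have the same function. The polynomial $p$ is closable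 if for every $j\in\mathbb{N}$ the set $\{\widehat p(x)x^{-j}:x\in K^*\}$ has an infimum in $K$; this infimum is then denoted $\overline p_j$. One has $\overline p_j=0$ for $j>\deg p$ and $\overline p_n=p_n$ for $n=\deg p$, so the $\overline p_j$ define a polynomial $\overline p\in K[X]$ called the closure of $p$. For $p$ closable of degree $n>0$, $\overline p$ factors as a formal polynomial as $p_n(X+c_1)\cdots(X+c_n)$ for a unique tuple with $c_1\geqslant\cdots\geqslant c_n$; these $c_k$ are the corners of $\overline p$, and $c_k=\overline p_{n-k}\,\overline p_{n-k+1}^{-1}$ if $\overline p_{n-k+1}\neq0$ and $c_k=0$ otherwise. For $\deg p=n>0$, the polynomial function $\widehat p$ splits in $K$ if there are $r_1,\dots,r_n\in K$ with $\widehat p(x)=p_n(x+r_1)\cdots(x+r_n)$ for all $x\in K$. *)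

theory Defs
  imports "HOL-Computational_Algebra.Polynomial" "HOL-Library.Lub_Glb"
begin

text \<open>
  Commutative idempotent semifields. Semirings here have no additive cancellation, so the
  library's classes of semidomains and fields do not apply. The operations \<open>inverse\<close>, \<open>/\<close>,
  \<open>\<le>\<close> and \<open><\<close> are determined by the semiring structure through the axioms, with the usual
  HOL convention \<open>inverse 0 = 0\<close>. Infinity of the carrier is left to the individual results.
\<close>

class idempotent_semifield = comm_semiring_1 + inverse + ord +
  assumes add_idem: "x + x = x"
    and semifield_left_inverse: "x \<noteq> 0 \<Longrightarrow> inverse x * x = 1"
    and semifield_inverse_zero: "inverse 0 = 0"
    and semifield_divide_inverse: "x / y = x * inverse y"
    and le_iff_add: "x \<le> y \<longleftrightarrow> x + y = y"
    and less_iff_le_neq: "x < y \<longleftrightarrow> x \<le> y \<and> x \<noteq> y"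
begin

subclass order
proof
  fix x y z :: 'a
  show "x \<le> x" by (simp add: le_iff_add add_idem)
  show "x \<le> z" if "x \<le> y" "y \<le> z"
    using that unfolding le_iff_add by (metis add.assoc)
  show antisym: "x = y" if "x \<le> y" "y \<le> x"
    using that unfolding le_iff_add by (metis add.commute)
  show "x < y \<longleftrightarrow> x \<le> y \<and> \<not> y \<le> x"
    unfolding less_iff_le_neq le_iff_add by (metis add.commute add_idem)
qed

end

text \<open>
  The set of all \<open>p(x) x\<^sup>-\<^sup>j\<close> for nonzero \<open>x\<close>, where \<open>poly p\<close> is the polynomial function of \<open>p\<close>.
\<close>

definition closure_values :: "'a::idempotent_semifield poly \<Rightarrow> nat \<Rightarrow> 'a set" where
  "closure_values p j = {poly p x * inverse x ^ j | x. x \<noteq> 0}"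

definition closable :: "'a::idempotent_semifield poly \<Rightarrow> bool" where
  "closable p \<longleftrightarrow> (\<forall>j. \<exists>m. isGlb UNIV (closure_values p j) m)"

text \<open>
  The closure has the infima as its coefficients. This determines a polynomial if \<open>p\<close> is
  closable and the semifield is infinite, see \<open>isGlb_coeff_poly_closure\<close> below; otherwise the
  value is unspecified.
\<close>

definition poly_closure :: "'a::idempotent_semifield poly \<Rightarrow> 'a poly" where
  "poly_closure p = Abs_poly (\<lambda>j. THE m. isGlb UNIV (closure_values p j) m)"

text \<open>
  The tuple \<open>(c\<^sub>1, \<dots>, c\<^sub>n)\<close> is a list of length \<open>n\<close>. The factorization is one of formal
  polynomials; \<open>[:c, 1:]\<close> is \<open>X + c\<close>.
\<close>

definition is_corners :: "'a::idempotent_semifield poly \<Rightarrow> 'a list \<Rightarrow> bool" where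
  "is_corners q cs \<longleftrightarrow>
     length cs = degree q \<and> sorted_wrt (\<ge>) cs \<and>
     q = smult (coeff q (degree q)) (\<Prod>c\<leftarrow>cs. [:c, 1:])"

definition corners :: "'a::idempotent_semifield poly \<Rightarrow> 'a list" where
  "corners q = (THE cs. is_corners q cs)"

text \<open>Corners are numbered from 1, list positions from 0.\<close>

definition corner :: "'a::idempotent_semifield poly \<Rightarrow> nat \<Rightarrow> 'a" where
  "corner q k = corners q ! (k - 1)"

definition poly_fun_splits :: "'a::idempotent_semifield poly \<Rightarrow> bool" where
  "poly_fun_splits p \<longleftrightarrow>
     (\<exists>rs. length rs = degree p \<and>
           (\<forall>x. poly p x = coeff p (degree p) * (\<Prod>r\<leftarrow>rs. x + r)))"

lemma isGlb_UNIV_unique: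
  fixes m m' :: "'a::order"
  assumes "isGlb UNIV A m" "isGlb UNIV A m'"
  shows "m = m'"
  using assms unfolding isGlb_def isLb_def greatestP_def setle_def setge_def
  by (auto intro: antisym)

context idempotent_semifield
begin

lemma semifield_mult_left_mono: "x \<le> y \<Longrightarrow> z * x \<le> z * y"
  unfolding le_iff_add by (metis distrib_left)

lemma semifield_add_upper: "x \<le> x + y" "y \<le> x + y"
  unfolding le_iff_add by (metis add.assoc add_idem, metis add.assoc add.commute add_idem)

lemma semifield_add_least: "x \<le> z \<Longrightarrow> y \<le> z \<Longrightarrow> x + y \<le> z"
  unfolding le_iff_add by (metis add.assoc)

lemma semifield_mult_nonzero: "x \<noteq> 0 \<Longrightarrow> y \<noteq> 0 \<Longrightarrow> x * y \<noteq> 0"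
  by (metis mult.assoc mult.left_neutral mult_zero_right semifield_left_inverse)

lemma semifield_le_zero: "x \<le> 0 \<Longrightarrow> x = 0"
  unfolding le_iff_add by simp

lemma semifield_not_bounded:
  assumes "infinite (UNIV :: 'a set)"
  shows "\<exists>x. \<not> x \<le> b"
proof (rule ccontr)
  assume "\<nexists>x. \<not> x \<le> b"
  then have top: "x \<le> b" for x by blast
  have b0: "b \<noteq> 0"
    using top[of 1] semifield_le_zero by force
  have "b * b = b"
    using top[of "b * b"] semifield_mult_left_mono[OF top[of 1], of b] by (simp add: order.antisym)
  then have "b = 1"
    using b0 by (metis mult.assoc mult.left_neutral semifield_left_inverse)
  have "x = 1" if "x \<noteq> 0" for x
  proof (rule order.antisym)
    show "x \<le> 1" using top \<open>b = 1\<close> by simp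
    have "x * inverse x \<le> x * 1"
      using top[of "inverse x"] \<open>b = 1\<close> by (intro semifield_mult_left_mono) simp
    then show "1 \<le> x" using semifield_left_inverse[OF that] by (simp add: mult.commute[of x])
  qed
  then have "UNIV \<subseteq> {0, 1 :: 'a}" by blast
  with assms show False using finite_subset by blast
qed

end

lemma semifield_sum_least:
  fixes f :: "'b \<Rightarrow> 'a::idempotent_semifield"
  assumes "finite A" "\<And>i. i \<in> A \<Longrightarrow> f i \<le> z"
  shows "sum f A \<le> z"
  using assms
  by (induction A rule: finite_induct) (auto intro!: semifield_add_least simp: le_iff_add[of 0])

lemma semifield_sum_upper:
  fixes f :: "'b \<Rightarrow> 'a::idempotent_semifield"
  assumes "finite A" "i \<in> A"
  shows "f i \<le> sum f A"
  using semifield_add_upper(1) assms by (simp add: sum.remove)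

lemma semifield_power_mono_exp:
  fixes x :: "'a::idempotent_semifield"
  assumes "1 \<le> x" "i \<le> j"
  shows "x ^ i \<le> x ^ j"
  using assms(2)
proof (induction j rule: dec_induct)
  case (step j)
  then show ?case
    using semifield_mult_left_mono[OF assms(1), of "x ^ j"]
    by (auto simp: mult.commute intro: order_trans)
qed simp

lemma closure_values_lower_bound_zero:
  fixes p :: "'a::idempotent_semifield poly"
  assumes inf: "infinite (UNIV :: 'a set)" and j: "degree p < j"
    and lb: "\<And>v. v \<in> closure_values p j \<Longrightarrow> m \<le> v"
  shows "m = 0"
proof (rule ccontr)
  assume m: "m \<noteq> 0"
  define s where "s = (\<Sum>i\<le>degree p. coeff p i)"
  have *: "m * x \<le> s" if x: "1 \<le> x" for x
  proof -
    have x0: "x \<noteq> 0" using x semifield_le_zero[of 1] by auto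
    have "poly p x \<le> s * x ^ degree p"
      unfolding poly_altdef
    proof (rule semifield_sum_least)
      fix i assume i: "i \<in> {..degree p}"
      have "coeff p i * x ^ i \<le> coeff p i * x ^ degree p"
        using i x by (intro semifield_mult_left_mono semifield_power_mono_exp) auto
      also have "\<dots> \<le> s * x ^ degree p"
        using semifield_mult_left_mono[OF semifield_sum_upper[of "{..degree p}" i "coeff p"],
            of "x ^ degree p"] i
        by (simp add: s_def mult.commute)
      finally show "coeff p i * x ^ i \<le> s * x ^ degree p" .
    qed simp
    moreover have "m * x ^ j \<le> poly p x"
    proof -
      have "x ^ j * m \<le> x ^ j * (poly p x * inverse x ^ j)"
        using x0 by (intro semifield_mult_left_mono lb) (auto simp: closure_values_def)
      also have "\<dots> = poly p x * (inverse x * x) ^ j"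
        by (simp add: power_mult_distrib ac_simps)
      also have "\<dots> = poly p x"
        using x0 by (simp add: semifield_left_inverse)
      finally show ?thesis
        by (simp add: mult.commute)
    qed
    moreover have "m * x ^ Suc (degree p) \<le> m * x ^ j"
      using x j by (intro semifield_mult_left_mono semifield_power_mono_exp) auto
    ultimately have "m * x ^ Suc (degree p) \<le> s * x ^ degree p"
      by (meson order_trans)
    then have "inverse x ^ degree p * (m * x ^ Suc (degree p))
        \<le> inverse x ^ degree p * (s * x ^ degree p)"
      by (rule semifield_mult_left_mono)
    then have "m * x * (inverse x * x) ^ degree p \<le> s * (inverse x * x) ^ degree p"
      by (simp add: power_mult_distrib ac_simps)
    then show ?thesis
      using x0 by (simp add: semifield_left_inverse)
  qed
  obtain y where y: "\<not> y \<le> inverse m * s"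
    using semifield_not_bounded[OF inf] by blast
  have "inverse m * (m * (y + 1)) \<le> inverse m * s"
    by (intro semifield_mult_left_mono * semifield_add_upper)
  then have "y + 1 \<le> inverse m * s"
    using m by (simp add: mult.assoc[symmetric] semifield_left_inverse)
  with y show False
    using semifield_add_upper(1) order_trans by blast
qed

lemma isGlb_coeff_poly_closure:
  fixes p :: "'a::idempotent_semifield poly"
  assumes "infinite (UNIV :: 'a set)" "closable p"
  shows "isGlb UNIV (closure_values p j) (coeff (poly_closure p) j)"
proof -
  let ?f = "\<lambda>j. THE m. isGlb UNIV (closure_values p j) m"
  have f: "isGlb UNIV (closure_values p j) (?f j)" for j
  proof (rule theI')
    show "\<exists>!m. isGlb UNIV (closure_values p j) m"
      using assms(2) isGlb_UNIV_unique unfolding closable_def by blast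
  qed
  have "?f j = 0" if "degree p < j" for j
    using closure_values_lower_bound_zero[OF assms(1) that, of "?f j"] f[of j]
    unfolding isGlb_def isLb_def greatestP_def setge_def by blast
  then have "\<forall>\<^sub>\<infinity>j. ?f j = 0"
    unfolding MOST_nat by blast
  then have "coeff (poly_closure p) = ?f"
    unfolding poly_closure_def by (simp add: Abs_poly_inverse)
  with f show ?thesis by simp
qed

end

theory Submission
  imports Defs
begin

text \<open>
  If \<open>p(x) = p\<^sub>n (x + r\<^sub>1) \<dots> (x + r\<^sub>n)\<close>, the roots can be sorted without changing the formal
  product. For sorted roots the coefficient at \<open>j\<close> is \<open>p\<^sub>n c\<^sub>1 \<dots> c\<^bsub>n-j\<^esub>\<close>, the value at
  \<open>x = c\<^bsub>n-j\<^esub>\<close> of \<open>p(x) x\<^sup>-\<^sup>j\<close>, so it is the infimum; if \<open>c\<^bsub>n-j\<^esub> = 0\<close> the infimum is \<open>0\<close>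
  because an infinite semifield is unbounded. Conversely, the coefficients \<open>q\<^sub>j\<close> of the closure
  satisfy \<open>q\<^sub>j q\<^bsub>j+2\<^esub> \<le> q\<^bsub>j+1\<^esub>\<^sup>2\<close>, since \<open>h \<le> a\<^sup>2\<close> for all \<open>a\<close> in a set implies \<open>h \<le> (inf a)\<^sup>2\<close>,
  and their vanishing propagates downwards. Hence the successive quotients decrease and are the
  roots of a factorization of the closure, which has the same polynomial function as \<open>p\<close>.
\<close>

section \<open>Order and cancellation in idempotent semifields\<close>

context idempotent_semifield
begin

subclass ordered_comm_semiring
proof
  show "c + a \<le> c + b" if "a \<le> b" for a b c
    using that unfolding le_iff_add by (metis add.assoc add.commute add_idem)
  show "c * a \<le> c * b" if "a \<le> b" "0 \<le> c" for a b c
    using that(1) by (rule semifield_mult_left_mono)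
qed

subclass semiring_1_no_zero_divisors
proof
  show "a * b \<noteq> 0" if "a \<noteq> 0" "b \<noteq> 0" for a b
    using that by (rule semifield_mult_nonzero)
qed

lemma semifield_right_inverse: "x \<noteq> 0 \<Longrightarrow> x * inverse x = 1"
  using semifield_left_inverse mult.commute by simp

lemma semifield_inverse_nonzero: "x \<noteq> 0 \<Longrightarrow> inverse x \<noteq> 0"
  by (metis mult_zero_left semifield_left_inverse zero_neq_one)

lemma semifield_zero_le: "0 \<le> x"
  by (simp add: le_iff_add)

lemma semifield_mult_mono: "a \<le> b \<Longrightarrow> c \<le> d \<Longrightarrow> a * c \<le> b * d"
  by (simp add: mult_mono semifield_zero_le)

lemma semifield_mult_conjugate: "x \<noteq> 0 \<Longrightarrow> x * y * inverse x = y"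
  by (metis mult.assoc mult.commute mult_1_right semifield_right_inverse)

lemma semifield_mult_left_cancel: "z \<noteq> 0 \<Longrightarrow> z * x = z * y \<longleftrightarrow> x = y"
  by (metis mult.assoc mult.left_neutral semifield_left_inverse)

lemma semifield_mult_left_le_cancel: "z \<noteq> 0 \<Longrightarrow> z * x \<le> z * y \<longleftrightarrow> x \<le> y"
  unfolding le_iff_add by (metis distrib_left semifield_mult_left_cancel)

lemma semifield_le_divide_iff: "z \<noteq> 0 \<Longrightarrow> x \<le> y * inverse z \<longleftrightarrow> x * z \<le> y"
  using semifield_mult_left_le_cancel[of z x "y * inverse z"]
  by (metis mult.assoc mult.commute mult_1_right semifield_left_inverse)

lemma semifield_add_eq_zero: "x + y = 0 \<longleftrightarrow> x = 0 \<and> y = 0"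
  by (metis add.right_neutral semifield_add_upper semifield_le_zero)

end

section \<open>Infima of closure values as limits at zero and at infinity\<close>

lemma isGlb_UNIV_iff:
  fixes m :: "'a::order"
  shows "isGlb UNIV A m \<longleftrightarrow> (\<forall>v\<in>A. m \<le> v) \<and> (\<forall>m'. (\<forall>v\<in>A. m' \<le> v) \<longrightarrow> m' \<le> m)"
  unfolding isGlb_def isLb_def greatestP_def setle_def setge_def by auto

text \<open>For nonzero \<open>b\<close>, the single choice \<open>y = 1 + s * inverse b\<close>
  already makes \<open>s * inverse y\<close> at most \<open>b\<close>. For \<open>b = 0\<close>, a
  nonzero \<open>m\<close> would keep every \<open>y\<close> below \<open>s * inverse m\<close>, but
  an infinite semifield is unbounded.\<close>

lemma le_if_le_add_mult_inverse:
  fixes m b s :: "'a::idempotent_semifield"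
  assumes inf: "infinite (UNIV :: 'a set)"
    and le: "\<And>y. 1 \<le> y \<Longrightarrow> m \<le> b + s * inverse y"
  shows "m \<le> b"
proof (cases "b = 0")
  case True
  show ?thesis
  proof (rule ccontr)
    assume "\<not> m \<le> b"
    then have m: "m \<noteq> 0" using semifield_zero_le by auto
    obtain y where y: "\<not> y \<le> s * inverse m"
      using semifield_not_bounded[OF inf] by blast
    have 1: "1 \<le> 1 + y" by (rule semifield_add_upper)
    then have "1 + y \<noteq> 0" using semifield_le_zero[of 1] by auto
    then have "(1 + y) * m \<le> s"
      using le[OF 1] True by (simp add: semifield_le_divide_iff mult.commute)
    then have "1 + y \<le> s * inverse m"
      using m by (simp add: semifield_le_divide_iff)
    with y show False using semifield_add_upper(2) order_trans by blast
  qed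
next
  case False
  define y where "y = 1 + s * inverse b"
  have 1: "1 \<le> y" unfolding y_def by (rule semifield_add_upper)
  then have y0: "y \<noteq> 0" using semifield_le_zero[of 1] by auto
  have "s * inverse b \<le> y" unfolding y_def by (rule semifield_add_upper)
  then have "b * (s * inverse b) \<le> b * y" by (rule semifield_mult_left_mono)
  moreover have "b * (s * inverse b) = s"
    using False by (metis mult.left_commute mult_1_right semifield_right_inverse)
  ultimately have "s \<le> b * y" by simp
  then have "s * inverse y \<le> b * y * inverse y"
    by (intro semifield_mult_mono) auto
  also have "\<dots> = b"
    using y0 by (simp add: mult.assoc semifield_right_inverse)
  finally show ?thesis
    using le[OF 1] semifield_add_least[of b b] order_trans by blast
qed

lemma semifield_power_cancel:
  fixes x :: "'a::idempotent_semifield"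
  assumes "x \<noteq> 0"
  shows "inverse x ^ j * x ^ (j + k) = x ^ k" "x ^ j * inverse x ^ (j + k) = inverse x ^ k"
proof -
  have *: "inverse x ^ j * x ^ j = 1"
    using assms by (simp add: power_mult_distrib[symmetric] semifield_left_inverse)
  have "inverse x ^ j * x ^ (j + k) = inverse x ^ j * x ^ j * x ^ k"
    by (simp add: power_add mult.assoc)
  then show "inverse x ^ j * x ^ (j + k) = x ^ k" by (simp add: *)
  have "x ^ j * inverse x ^ (j + k) = inverse x ^ j * x ^ j * inverse x ^ k"
    by (simp add: power_add ac_simps)
  then show "x ^ j * inverse x ^ (j + k) = inverse x ^ k" by (simp add: *)
qed

lemma closure_values_eq_sum:
  fixes p :: "'a::idempotent_semifield poly"
  shows "poly p x * inverse x ^ j = (\<Sum>i\<le>degree p. coeff p i * (x ^ i * inverse x ^ j))"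
  by (simp add: poly_altdef sum_distrib_right mult.assoc)

text \<open>Limit at zero, with \<open>x = inverse y\<close>: terms below \<open>j\<close> vanish by
  assumption, and each term above \<open>j\<close> keeps a factor \<open>x\<close> after division by
  \<open>x ^ j\<close>, so it is at most \<open>s * x\<close>.\<close>

lemma closure_values_lower_bound_low:
  fixes p :: "'a::idempotent_semifield poly"
  assumes inf: "infinite (UNIV :: 'a set)" and j: "\<And>i. i < j \<Longrightarrow> coeff p i = 0"
    and lb: "\<And>v. v \<in> closure_values p j \<Longrightarrow> m \<le> v"
  shows "m \<le> coeff p j"
proof (rule le_if_le_add_mult_inverse[OF inf])
  define s where "s = (\<Sum>i\<le>degree p. coeff p i)"
  fix y :: 'a assume y: "1 \<le> y"
  then have y0: "y \<noteq> 0" using semifield_le_zero[of 1] by auto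
  define x where "x = inverse y"
  have x0: "x \<noteq> 0" using y0 by (simp add: x_def semifield_inverse_nonzero)
  have x1: "x \<le> 1"
    using semifield_mult_left_mono[OF y, of x] y0 by (simp add: x_def semifield_left_inverse)
  have "m \<le> poly p x * inverse x ^ j"
    using x0 by (intro lb) (auto simp: closure_values_def)
  also have "\<dots> \<le> coeff p j + s * x"
    unfolding closure_values_eq_sum
  proof (rule semifield_sum_least)
    fix i assume i: "i \<in> {..degree p}"
    consider "i < j" | "i = j" | "i > j" by linarith
    then show "coeff p i * (x ^ i * inverse x ^ j) \<le> coeff p j + s * x"
    proof cases
      case 1
      then show ?thesis by (simp add: j semifield_zero_le)
    next
      case 2
      then show ?thesis
        using semifield_power_cancel(1)[OF x0, of j 0] semifield_add_upper(1)
        by (simp add: mult.commute)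
    next
      case 3
      then obtain k where k: "i = j + Suc k" using less_imp_Suc_add by auto
      have "x ^ i * inverse x ^ j = x * x ^ k"
        using semifield_power_cancel(1)[OF x0, of j "Suc k"] k by (simp add: mult.commute)
      also have "\<dots> \<le> x * 1"
      proof (rule semifield_mult_left_mono)
        show "x ^ k \<le> 1"
          by (induction k) (use x1 semifield_mult_mono[of x 1 _ 1] in auto)
      qed
      finally have "coeff p i * (x ^ i * inverse x ^ j) \<le> s * x"
        using semifield_sum_upper[of "{..degree p}" i "coeff p"] i
        by (intro semifield_mult_mono) (auto simp: s_def)
      then show ?thesis using semifield_add_upper(2) order_trans by blast
    qed
  qed simp
  finally show "m \<le> coeff p j + s * inverse y" by (simp add: x_def)
qed

text \<open>Limit at infinity, the mirror image: terms below \<open>j\<close> keep a factor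
  \<open>inverse x\<close>.\<close>

lemma closure_values_lower_bound_high:
  fixes p :: "'a::idempotent_semifield poly"
  assumes inf: "infinite (UNIV :: 'a set)" and j: "degree p \<le> j"
    and lb: "\<And>v. v \<in> closure_values p j \<Longrightarrow> m \<le> v"
  shows "m \<le> coeff p j"
proof (rule le_if_le_add_mult_inverse[OF inf])
  define s where "s = (\<Sum>i\<le>degree p. coeff p i)"
  fix x :: 'a assume x: "1 \<le> x"
  then have x0: "x \<noteq> 0" using semifield_le_zero[of 1] by auto
  have x1: "inverse x \<le> 1"
    using semifield_mult_left_mono[OF x, of "inverse x"] x0 by (simp add: semifield_left_inverse)
  have "m \<le> poly p x * inverse x ^ j"
    using x0 by (intro lb) (auto simp: closure_values_def)
  also have "\<dots> \<le> coeff p j + s * inverse x"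
    unfolding closure_values_eq_sum
  proof (rule semifield_sum_least)
    fix i assume i: "i \<in> {..degree p}"
    consider "i = j" | "i < j" using i j by fastforce
    then show "coeff p i * (x ^ i * inverse x ^ j) \<le> coeff p j + s * inverse x"
    proof cases
      case 1
      then show ?thesis
        using semifield_power_cancel(1)[OF x0, of j 0] semifield_add_upper(1)
        by (simp add: mult.commute)
    next
      case 2
      then obtain k where k: "j = i + Suc k" using less_imp_Suc_add by auto
      have "x ^ i * inverse x ^ j = inverse x * inverse x ^ k"
        using semifield_power_cancel(2)[OF x0, of i "Suc k"] k by simp
      also have "\<dots> \<le> inverse x * 1"
      proof (rule semifield_mult_left_mono)
        show "inverse x ^ k \<le> 1"
          by (induction k) (use x1 semifield_mult_mono[of "inverse x" 1 _ 1] in auto)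
      qed
      finally have "coeff p i * (x ^ i * inverse x ^ j) \<le> s * inverse x"
        using semifield_sum_upper[of "{..degree p}" i "coeff p"] i
        by (intro semifield_mult_mono) (auto simp: s_def)
      then show ?thesis using semifield_add_upper(2) order_trans by blast
    qed
  qed simp
  finally show "m \<le> coeff p j + s * inverse x" .
qed

lemma coeff_power_le_poly:
  fixes p :: "'a::idempotent_semifield poly"
  shows "coeff p j * x ^ j \<le> poly p x"
proof (cases "j \<le> degree p")
  case True
  then show ?thesis
    unfolding poly_altdef
    using semifield_sum_upper[of "{..degree p}" j "\<lambda>i. coeff p i * x ^ i"] by simp
qed (simp add: coeff_eq_0 semifield_zero_le)

lemma coeff_le_closure_values:
  fixes p :: "'a::idempotent_semifield poly"
  assumes "v \<in> closure_values p j"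
  shows "coeff p j \<le> v"
proof -
  obtain x where x: "x \<noteq> 0" "v = poly p x * inverse x ^ j"
    using assms by (auto simp: closure_values_def)
  have "coeff p j * x ^ j * inverse x ^ j \<le> v"
    unfolding x(2) by (intro semifield_mult_mono coeff_power_le_poly) simp
  then show ?thesis
    using semifield_power_cancel(1)[OF x(1), of j 0] by (simp add: mult.assoc mult.commute[of "x ^ j"])
qed

lemma isGlb_closure_values_low:
  fixes p :: "'a::idempotent_semifield poly"
  assumes "infinite (UNIV :: 'a set)" "\<And>i. i < j \<Longrightarrow> coeff p i = 0"
  shows "isGlb UNIV (closure_values p j) (coeff p j)"
  using closure_values_lower_bound_low[OF assms] coeff_le_closure_values
  unfolding isGlb_UNIV_iff by blast

lemma isGlb_closure_values_high:
  fixes p :: "'a::idempotent_semifield poly"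
  assumes "infinite (UNIV :: 'a set)" "degree p \<le> j"
  shows "isGlb UNIV (closure_values p j) (coeff p j)"
  using closure_values_lower_bound_high[OF assms] coeff_le_closure_values
  unfolding isGlb_UNIV_iff by blast

section \<open>Products of linear factors with sorted roots\<close>

text \<open>Addition is supremum, so among the products of \<open>length cs - j\<close> roots the
  one over the largest roots absorbs all others. In the induction, the old coefficient at
  \<open>i\<close> has the extra root \<open>cs ! k \<le> c\<close> and is absorbed by
  \<open>c\<close> times the old coefficient at \<open>Suc i\<close>.\<close>

lemma coeff_prod_list_sorted:
  fixes cs :: "'a::idempotent_semifield list"
  assumes "sorted_wrt (\<ge>) cs"
  shows "coeff (\<Prod>c\<leftarrow>cs. [:c, 1:]) j =
    (if j \<le> length cs then prod_list (take (length cs - j) cs) else 0)"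
  using assms
proof (induction cs arbitrary: j)
  case Nil
  then show ?case by (simp add: coeff_1)
next
  case (Cons c cs)
  have IH: "coeff (\<Prod>c\<leftarrow>cs. [:c, 1:]) j =
      (if j \<le> length cs then prod_list (take (length cs - j) cs) else 0)" for j
    using Cons by simp
  show ?case
  proof (cases j)
    case 0
    then show ?thesis by (simp add: IH)
  next
    case (Suc i)
    consider "i > length cs" | "i = length cs" | "i < length cs" by linarith
    then show ?thesis
    proof cases
      case 3
      then obtain k where k: "length cs = Suc i + k" using less_imp_Suc_add by auto
      have "cs ! k \<le> c" using Cons.prems k by simp
      then have "cs ! k * prod_list (take k cs) \<le> c * prod_list (take k cs)"
        by (intro semifield_mult_mono) auto
      then show ?thesis
        using k by (simp add: Suc IH le_iff_add add.commute Suc_diff_le take_Suc_conv_app_nth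
            mult.commute)
    qed (simp_all add: Suc IH)
  qed
qed

lemma poly_prod_list_linear:
  fixes x :: "'a::comm_semiring_1"
  shows "poly (\<Prod>c\<leftarrow>cs. [:c, 1:]) x = (\<Prod>c\<leftarrow>cs. x + c)"
  by (induction cs) (simp_all add: algebra_simps)

text \<open>In each factor the larger summand wins: roots up to position \<open>k\<close> contribute
  themselves, later ones contribute \<open>cs ! k\<close>.\<close>

lemma prod_list_add_nth_sorted:
  fixes cs :: "'a::idempotent_semifield list"
  assumes "sorted_wrt (\<ge>) cs" "k < length cs"
  shows "(\<Prod>c\<leftarrow>cs. cs ! k + c) = prod_list (take (Suc k) cs) * (cs ! k) ^ (length cs - Suc k)"
  using assms
proof (induction cs arbitrary: k)
  case (Cons c cs)
  show ?case
  proof (cases k)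
    case 0
    have "(\<Prod>r\<leftarrow>rs. c + r) = c ^ length rs" if "\<forall>r\<in>set rs. r \<le> c" for rs
      using that by (induction rs) (simp_all add: le_iff_add add.commute)
    from this[of cs] show ?thesis using Cons.prems 0 by (simp add: add_idem)
  next
    case (Suc i)
    then have "cs ! i + c = c" using Cons.prems by (simp add: le_iff_add)
    then show ?thesis using Cons Suc by (simp add: mult.assoc)
  qed
qed simp

section \<open>Sorting the roots\<close>

text \<open>The infimum, written as \<open>r * c * inverse (r + c)\<close>. It lies below each
  argument because the other one divided by \<open>r + c\<close> is at most
  \<open>1\<close>.\<close>

lemma semifield_meet:
  fixes r c :: "'a::idempotent_semifield"
  obtains d where "d \<le> r" "d \<le> c" "(r + c) * d = r * c"
proof (cases "r + c = 0")
  case True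
  then show ?thesis using that[of 0] by (auto simp: semifield_add_eq_zero)
next
  case False
  have *: "y * inverse (r + c) \<le> 1" if "y \<le> r + c" for y
    using False semifield_mult_mono[OF that order_refl, of "inverse (r + c)"]
    by (simp add: semifield_right_inverse)
  show ?thesis
  proof (rule that)
    show "r * c * inverse (r + c) \<le> r"
      using semifield_mult_left_mono[OF *[OF semifield_add_upper(2)], of r] by (simp add: mult.assoc)
    show "r * c * inverse (r + c) \<le> c"
      using semifield_mult_left_mono[OF *[OF semifield_add_upper(1)], of c] by (simp add: ac_simps)
    show "(r + c) * (r * c * inverse (r + c)) = r * c"
      using False by (metis mult.left_commute mult_1_right semifield_right_inverse)
  qed
qed

text \<open>
  Sorting of roots in a merely lattice-ordered semifield: formally \<open>(X + a) (X + b)\<close> equals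
  \<open>(X + sup a b) (X + inf a b)\<close>, because \<open>sup a b * inf a b = a * b\<close>.
\<close>

lemma sorted_linear_product_insert:
  fixes cs :: "'a::idempotent_semifield list"
  assumes "sorted_wrt (\<ge>) cs"
  shows "\<exists>ds. length ds = Suc (length cs) \<and> sorted_wrt (\<ge>) ds \<and>
    (\<Prod>c\<leftarrow>ds. [:c, 1:]) = [:r, 1:] * (\<Prod>c\<leftarrow>cs. [:c, 1:]) \<and>
    (\<forall>b. r \<le> b \<longrightarrow> (\<forall>c\<in>set cs. c \<le> b) \<longrightarrow> (\<forall>d\<in>set ds. d \<le> b))"
  using assms
proof (induction cs arbitrary: r)
  case Nil
  show ?case by (intro exI[of _ "[r]"]) auto
next
  case (Cons c cs)
  obtain d where d: "d \<le> r" "d \<le> c" "(r + c) * d = r * c"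
    by (rule semifield_meet)
  \<comment> \<open>The supremum \<open>r + c\<close> becomes the head; the infimum \<open>d\<close>
    may be incomparable with entries of \<open>cs\<close>, so it is inserted recursively.\<close>
  obtain ds where ds: "length ds = Suc (length cs)" "sorted_wrt (\<ge>) ds"
    "(\<Prod>c\<leftarrow>ds. [:c, 1:]) = [:d, 1:] * (\<Prod>c\<leftarrow>cs. [:c, 1:])"
    "\<And>b. d \<le> b \<Longrightarrow> \<forall>c\<in>set cs. c \<le> b \<Longrightarrow> \<forall>d\<in>set ds. d \<le> b"
    using Cons.IH[of d] Cons.prems unfolding sorted_wrt.simps by blast
  have "r + c + d = r + c"
    using d(1) by (metis add.assoc add.commute le_iff_add)
  then have "[:r + c, 1:] * [:d, 1:] = [:r, 1:] * [:c, 1:]"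
    using d(3) by simp (metis add.commute mult.commute)
  then have prod: "(\<Prod>c\<leftarrow>(r + c) # ds. [:c, 1:]) = [:r, 1:] * (\<Prod>c\<leftarrow>c # cs. [:c, 1:])"
    unfolding list.map prod_list.Cons ds(3) mult.assoc[symmetric] by (rule arg_cong)
  have c: "c \<le> r + c" by (rule semifield_add_upper)
  \<comment> \<open>The clause on upper bounds strengthens the induction for this purpose:
    \<open>r + c\<close> bounds \<open>d\<close> and \<open>cs\<close>, hence also
    \<open>ds\<close>.\<close>
  have "\<forall>d\<in>set ds. d \<le> r + c"
  proof (rule ds(4))
    show "d \<le> r + c" using d(2) c by (rule order_trans)
    show "\<forall>x\<in>set cs. x \<le> r + c" using Cons.prems c by auto
  qed
  then have sorted: "sorted_wrt (\<ge>) ((r + c) # ds)" using ds(2) by simp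
  have bound: "\<forall>x\<in>set ((r + c) # ds). x \<le> b"
    if "r \<le> b" "\<forall>x\<in>set (c # cs). x \<le> b" for b
  proof -
    have "d \<le> b" using d(1) that(1) by (rule order_trans)
    then show ?thesis
      using that ds(4)[of b] semifield_add_least[of r b c] by simp
  qed
  have len: "length ((r + c) # ds) = Suc (length (c # cs))"
    using ds(1) by simp
  show ?case
    by (rule exI[of _ "(r + c) # ds"]) (intro conjI allI impI len sorted prod bound)
qed

lemma sorted_linear_product:
  fixes rs :: "'a::idempotent_semifield list"
  obtains cs where "length cs = length rs" "sorted_wrt (\<ge>) cs"
    "(\<Prod>c\<leftarrow>cs. [:c, 1:]) = (\<Prod>r\<leftarrow>rs. [:r, 1:])"
proof -
  have "\<exists>cs. length cs = length rs \<and> sorted_wrt (\<ge>) cs \<and>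
    (\<Prod>c\<leftarrow>cs. [:c, 1:]) = (\<Prod>r\<leftarrow>rs. [:r, 1:])"
  proof (induction rs)
    case (Cons r rs)
    then obtain cs where "length cs = length rs" "sorted_wrt (\<ge>) cs"
      "(\<Prod>c\<leftarrow>cs. [:c, 1:]) = (\<Prod>r\<leftarrow>rs. [:r, 1:])"
      by blast
    with sorted_linear_product_insert[of cs r] show ?case
      unfolding list.map prod_list.Cons by (metis length_Cons)
  qed simp
  with that show ?thesis by blast
qed

section \<open>Sorted products are their own closures; uniqueness of corners\<close>

context
  fixes cs :: "'a::idempotent_semifield list" and a :: 'a and q :: "'a poly"
  assumes sorted: "sorted_wrt (\<ge>) cs"
  defines "q \<equiv> smult a (\<Prod>c\<leftarrow>cs. [:c, 1:])"
begin

lemma coeff_sorted_product: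
  "coeff q j = (if j \<le> length cs then a * prod_list (take (length cs - j) cs) else 0)"
  by (simp add: q_def coeff_prod_list_sorted[OF sorted])

lemma degree_sorted_product_le: "degree q \<le> length cs"
  by (rule degree_le) (simp add: coeff_sorted_product)

lemma degree_sorted_product: "a \<noteq> 0 \<Longrightarrow> degree q = length cs"
  using degree_sorted_product_le le_degree[of q "length cs"]
  by (simp add: coeff_sorted_product)

lemma coeff_sorted_product_Suc:
  assumes "j < length cs"
  shows "coeff q j = coeff q (Suc j) * cs ! (length cs - Suc j)"
proof -
  obtain k where "length cs = Suc j + k" using assms less_imp_Suc_add by auto
  then show ?thesis
    by (simp add: coeff_sorted_product Suc_diff_le take_Suc_conv_app_nth mult.assoc)
qed

lemma poly_sorted_product:
  assumes "j < length cs"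
  shows "poly q (cs ! (length cs - Suc j)) = coeff q j * (cs ! (length cs - Suc j)) ^ j"
proof -
  obtain k where k: "length cs = Suc j + k" using assms less_imp_Suc_add by auto
  have "coeff q j = a * prod_list (take (Suc k) cs)"
    using k by (simp add: coeff_sorted_product Suc_diff_le)
  moreover have "poly q x = a * (\<Prod>c\<leftarrow>cs. x + c)" for x
    by (simp add: q_def poly_prod_list_linear)
  ultimately show ?thesis
    using prod_list_add_nth_sorted[OF sorted, of k] k by (simp add: mult.assoc)
qed

text \<open>A nonzero root \<open>c\<close> at position \<open>length cs - Suc j\<close> is a point
  where the coefficient is attained as a closure value. If \<open>c = 0\<close>, that root occurs in
  every lower coefficient, so these vanish and the limit at zero applies.\<close>

lemma isGlb_closure_values_sorted_product:
  assumes inf: "infinite (UNIV :: 'a set)"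
  shows "isGlb UNIV (closure_values q j) (coeff q j)"
proof (cases "j < length cs")
  case False
  then show ?thesis
    using degree_sorted_product_le by (intro isGlb_closure_values_high[OF inf]) simp
next
  case j: True
  define c where "c = cs ! (length cs - Suc j)"
  show ?thesis
  proof (cases "c = 0")
    case True
    show ?thesis
    proof (rule isGlb_closure_values_low[OF inf])
      fix i assume i: "i < j"
      have "c \<in> set (take (length cs - i) cs)"
        unfolding in_set_conv_nth c_def using i j by (intro exI[of _ "length cs - Suc j"]) auto
      then show "coeff q i = 0"
        using True by (simp add: coeff_sorted_product prod_list_zero_iff)
    qed
  next
    case False
    then have "coeff q j = poly q c * inverse c ^ j"
      using semifield_power_cancel(1)[of c j 0]
      by (simp add: poly_sorted_product[OF j, folded c_def] mult.assoc mult.commute[of "c ^ j"])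
    then have "coeff q j \<in> closure_values q j"
      using False by (auto simp: closure_values_def)
    then show ?thesis
      using coeff_le_closure_values unfolding isGlb_UNIV_iff by blast
  qed
qed

text \<open>Coefficients determine the sorted roots, which gives uniqueness of corners. After a zero
  root all later ones are zero by sortedness, in agreement with
  \<open>inverse 0 = 0\<close>.\<close>

lemma nth_eq_coeff_sorted_product:
  assumes "a \<noteq> 0" "k < length cs"
  shows "cs ! k = coeff q (length cs - Suc k) * inverse (coeff q (length cs - k))"
proof (cases "prod_list (take k cs) = 0")
  case False
  have "prod_list (take (Suc k) cs) = cs ! k * prod_list (take k cs)"
    using assms(2) by (simp add: take_Suc_conv_app_nth mult.commute)
  then have "coeff q (length cs - Suc k) = cs ! k * coeff q (length cs - k)"
    using assms(2) by (simp add: coeff_sorted_product mult.left_commute)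
  moreover have "coeff q (length cs - k) \<noteq> 0"
    using False assms by (simp add: coeff_sorted_product)
  ultimately show ?thesis
    by (simp add: mult.assoc semifield_right_inverse)
next
  case True
  then obtain i where i: "i < k" "cs ! i = 0"
    using assms(2) by (auto simp: prod_list_zero_iff in_set_conv_nth)
  then have "cs ! k \<le> 0"
    using sorted assms(2) unfolding sorted_wrt_iff_nth_less by metis
  then have "cs ! k = 0" by (rule semifield_le_zero)
  then show ?thesis
    using True assms by (simp add: coeff_sorted_product semifield_inverse_zero)
qed

end

lemma is_corners_unique:
  fixes q :: "'a::idempotent_semifield poly"
  assumes "q \<noteq> 0" "is_corners q cs" "is_corners q ds"
  shows "cs = ds"
proof (rule nth_equalityI)
  show "length cs = length ds"
    using assms by (simp add: is_corners_def)
  have nth: "es ! k = coeff q (degree q - Suc k) * inverse (coeff q (degree q - k))"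
    if "is_corners q es" "k < degree q" for es k
  proof -
    have es: "length es = degree q" "sorted_wrt (\<ge>) es"
      "smult (coeff q (degree q)) (\<Prod>c\<leftarrow>es. [:c, 1:]) = q"
      using that(1) unfolding is_corners_def by metis+
    show ?thesis
      using nth_eq_coeff_sorted_product[OF es(2), of "coeff q (degree q)" k] assms(1) that(2)
      unfolding es(1,3) by simp
  qed
  show "cs ! k = ds ! k" if "k < length cs" for k
    using that nth assms(2,3) by (simp add: is_corners_def)
qed

section \<open>Squares and infima\<close>

text \<open>Since \<open>u\<close> and \<open>v\<close> may be incomparable, both sides are
  multiplied by \<open>u + v\<close>: the left one becomes two of the four terms of the right one,
  and \<open>u + v\<close> cancels.\<close>

lemma mult_le_add_squares:
  fixes u v :: "'a::idempotent_semifield"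
  shows "u * v \<le> u * u + v * v"
proof (cases "u + v = 0")
  case False
  have "(u + v) * (u * u + v * v) = (u + v) * (u * v) + (u * (u * u) + v * (v * v))"
    by (simp add: distrib_left distrib_right ac_simps)
  then have "(u + v) * (u * v) \<le> (u + v) * (u * u + v * v)"
    by (simp add: semifield_add_upper)
  then show ?thesis using semifield_mult_left_le_cancel[OF False] by blast
qed (simp add: semifield_add_eq_zero)

text \<open>The previous inequality, applied to the inverses of \<open>a\<close> and
  \<open>b\<close> and multiplied by \<open>h\<close>.\<close>

lemma le_mult_if_le_squares:
  fixes a b h :: "'a::idempotent_semifield"
  assumes "h \<le> a * a" "h \<le> b * b"
  shows "h \<le> a * b"
proof (cases "a = 0 \<or> b = 0")
  case True
  then have "h = 0" using assms by (auto dest: semifield_le_zero)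
  then show ?thesis by (simp add: semifield_zero_le)
next
  case False
  define u v where "u = inverse a" and "v = inverse b"
  have *: "h * (inverse x * inverse x) \<le> 1" if "x \<noteq> 0" "h \<le> x * x" for x
  proof -
    have "h * (inverse x * inverse x) \<le> x * x * (inverse x * inverse x)"
      using that(2) by (intro semifield_mult_mono) auto
    also have "\<dots> = (x * inverse x) * (x * inverse x)"
      by (simp only: ac_simps)
    finally show ?thesis using that(1) by (simp add: semifield_right_inverse)
  qed
  have "h * (u * u) \<le> 1" "h * (v * v) \<le> 1"
    using False assms unfolding u_def v_def by (auto intro!: *)
  then have "h * (u * u + v * v) \<le> 1"
    by (simp add: distrib_left semifield_add_least)
  then have "h * (u * v) \<le> 1"
    using semifield_mult_left_mono[OF mult_le_add_squares] order_trans by blast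
  then have "h * (u * v) * (a * b) \<le> 1 * (a * b)"
    by (intro semifield_mult_mono) auto
  moreover have "h * (u * v) * (a * b) = h * ((a * u) * (b * v))"
    by (simp add: ac_simps)
  ultimately show ?thesis
    using False by (simp add: u_def v_def semifield_right_inverse)
qed

text \<open>The bound extends from squares to products \<open>a * b\<close> of two elements of
  \<open>A\<close>. Then the infimum is taken in one factor at a time: \<open>h * inverse a\<close>
  is a lower bound of \<open>A\<close>, whence \<open>h \<le> g * a\<close>; then so is
  \<open>h * inverse g\<close>.\<close>

lemma isGlb_square:
  fixes g h :: "'a::idempotent_semifield"
  assumes g: "isGlb UNIV A g" and "A \<noteq> {}" and h: "\<And>a. a \<in> A \<Longrightarrow> h \<le> a * a"
  shows "h \<le> g * g"
proof -
  have glb: "m \<le> g" if "\<And>a. a \<in> A \<Longrightarrow> m \<le> a" for m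
    using g that unfolding isGlb_UNIV_iff by blast
  have *: "h \<le> g * a" if a: "a \<in> A" for a
  proof (cases "a = 0")
    case False
    have "h * inverse a \<le> g"
    proof (rule glb)
      fix b assume "b \<in> A"
      then have "h \<le> a * b" using a h le_mult_if_le_squares by blast
      then have "h * inverse a \<le> a * b * inverse a"
        by (intro semifield_mult_mono) auto
      also have "\<dots> = b"
        using False by (rule semifield_mult_conjugate)
      finally show "h * inverse a \<le> b" .
    qed
    then have "h * inverse a * a \<le> g * a" by (intro semifield_mult_mono) auto
    then show ?thesis using False by (simp add: mult.assoc semifield_left_inverse)
  qed (use h[OF a] in simp)
  show ?thesis
  proof (cases "g = 0")
    case True
    then show ?thesis using * \<open>A \<noteq> {}\<close> by auto
  next
    case False
    have "h * inverse g \<le> g"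
    proof (rule glb)
      fix a assume "a \<in> A"
      then have "h * inverse g \<le> g * a * inverse g"
        by (intro semifield_mult_mono *) auto
      also have "\<dots> = a"
        using False by (rule semifield_mult_conjugate)
      finally show "h * inverse g \<le> a" .
    qed
    then have "h * inverse g * g \<le> g * g" by (intro semifield_mult_mono) auto
    then show ?thesis using False by (simp add: mult.assoc semifield_left_inverse)
  qed
qed

lemma closure_values_nonempty: "closure_values p j \<noteq> {}"
proof -
  have "poly p 1 * inverse 1 ^ j \<in> closure_values p j"
    unfolding closure_values_def by (intro CollectI exI[of _ 1] conjI) simp_all
  then show ?thesis by blast
qed

text \<open>In place of a case split at \<open>1\<close>, which needs a linear order, both sides are
  multiplied by the geometric sum \<open>S\<close>. The terms of \<open>S * x\<close> are terms of
  \<open>S\<close> and \<open>x ^ Suc d\<close>, and \<open>S\<close> is at least \<open>1\<close>,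
  so it cancels.\<close>

lemma le_one_add_power_Suc:
  fixes x :: "'a::idempotent_semifield"
  shows "x \<le> 1 + x ^ Suc d"
proof -
  define S where "S = (\<Sum>i\<le>d. x ^ i)"
  have "1 \<le> S"
    unfolding S_def using semifield_sum_upper[of "{..d}" 0 "\<lambda>i. x ^ i"] by simp
  then have S0: "S \<noteq> 0" using semifield_le_zero[of 1] by auto
  have "S * x \<le> S + x ^ Suc d"
    unfolding S_def sum_distrib_right
  proof (rule semifield_sum_least)
    fix i assume i: "i \<in> {..d}"
    show "x ^ i * x \<le> (\<Sum>i\<le>d. x ^ i) + x ^ Suc d"
    proof (cases "i = d")
      case True
      then show ?thesis by (simp only: semifield_add_upper flip: power_Suc2)
    next
      case False
      then have "x ^ Suc i \<le> (\<Sum>i\<le>d. x ^ i)"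
        using i by (intro semifield_sum_upper) auto
      also have "\<dots> \<le> (\<Sum>i\<le>d. x ^ i) + x ^ Suc d"
        by (rule semifield_add_upper)
      finally show ?thesis by (simp only: power_Suc2)
    qed
  qed simp
  also have "\<dots> \<le> S + S * x ^ Suc d"
    using semifield_mult_mono[OF \<open>1 \<le> S\<close> order_refl, of "x ^ Suc d"]
    by (intro add_left_mono) (simp only: mult_1_left)
  also have "\<dots> = S * (1 + x ^ Suc d)"
    by (simp only: distrib_left mult_1_right)
  finally show ?thesis using semifield_mult_left_le_cancel[OF S0] by blast
qed

section \<open>Factorization from concave coefficients\<close>

text \<open>Successive quotients of coefficients are the roots: \<open>concave\<close> makes them
  decrease, and \<open>upward\<close> lets their products telescope across zero
  coefficients.\<close>

lemma linear_factorization: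
  fixes q :: "'a::idempotent_semifield poly"
  assumes deg: "degree q = n" and q0: "q \<noteq> 0"
    and concave: "\<And>j. coeff q j * coeff q (Suc (Suc j)) \<le> coeff q (Suc j) * coeff q (Suc j)"
    and upward: "\<And>j. j < n \<Longrightarrow> coeff q j \<noteq> 0 \<Longrightarrow> coeff q (Suc j) \<noteq> 0"
  obtains cs where "length cs = n" "sorted_wrt (\<ge>) cs"
    "q = smult (coeff q n) (\<Prod>c\<leftarrow>cs. [:c, 1:])"
proof -
  \<comment> \<open>Position \<open>k\<close> holds corner number \<open>k + 1\<close>.\<close>
  define cs where "cs = map (\<lambda>k. coeff q (n - Suc k) * inverse (coeff q (n - k))) [0..<n]"
  have len: "length cs = n" by (simp add: cs_def)
  have sorted: "sorted_wrt (\<ge>) cs"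
  proof (subst sorted_wrt_iff_nth_Suc_transp)
    show "transp (\<lambda>x y :: 'a. x \<ge> y)" by (auto intro: transpI)
    show "\<forall>i. Suc i < length cs \<longrightarrow> cs ! i \<ge> cs ! Suc i"
    proof (intro allI impI)
      fix i assume i: "Suc i < length cs"
      then obtain j where j: "n = Suc (Suc (i + j))" using len less_imp_Suc_add[of "Suc i" n] by auto
      let ?a = "coeff q j" and ?b = "coeff q (Suc j)" and ?c = "coeff q (Suc (Suc j))"
      have "?a * inverse ?b \<le> ?b * inverse ?c"
      proof (cases "?b = 0")
        case True
        then show ?thesis by (simp add: semifield_inverse_zero semifield_zero_le)
      next
        case False
        then have c: "?c \<noteq> 0" using upward[of "Suc j"] j by simp
        have "?a * ?c * inverse ?b \<le> ?b * ?b * inverse ?b"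
          by (intro semifield_mult_mono concave) simp
        then have "?a * inverse ?b * ?c \<le> ?b"
          using False by (simp add: mult.assoc semifield_right_inverse mult.commute[of ?c "inverse ?b"])
        then show ?thesis using c by (simp add: semifield_le_divide_iff)
      qed
      moreover have "cs ! Suc i = ?a * inverse ?b" "cs ! i = ?b * inverse ?c"
        using j by (simp_all add: cs_def nth_append Suc_diff_le del: upt_Suc)
      ultimately show "cs ! i \<ge> cs ! Suc i" by simp
    qed
  qed
  have prod: "coeff q n * prod_list (take k cs) = coeff q (n - k)" if "k \<le> n" for k
    using that
  proof (induction k)
    case (Suc k)
    then have k: "Suc (n - Suc k) = n - k" by simp
    have "coeff q n * prod_list (take (Suc k) cs) = coeff q (n - k) * cs ! k"
      using Suc len by (simp add: take_Suc_conv_app_nth flip: mult.assoc)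
    also have "\<dots> = coeff q (n - Suc k) * (coeff q (n - k) * inverse (coeff q (n - k)))"
      using Suc by (simp add: cs_def ac_simps)
    \<comment> \<open>At a zero coefficient nothing cancels, but there \<open>upward\<close> makes
      the next lower coefficient zero as well.\<close>
    also have "\<dots> = coeff q (n - Suc k)"
    proof (cases "coeff q (n - k) = 0")
      case True
      then have "coeff q (n - Suc k) = 0"
        using upward[of "n - Suc k"] Suc.prems k by auto
      then show ?thesis by simp
    qed (simp add: semifield_right_inverse)
    finally show ?case .
  qed simp
  have "q = smult (coeff q n) (\<Prod>c\<leftarrow>cs. [:c, 1:])"
  proof (rule poly_eqI)
    show "coeff q j = coeff (smult (coeff q n) (\<Prod>c\<leftarrow>cs. [:c, 1:])) j" for j
      using prod[of "n - j"] deg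
      by (cases "j \<le> n") (simp_all add: coeff_prod_list_sorted[OF sorted] len coeff_eq_0)
  qed
  with that len sorted show ?thesis by blast
qed

section \<open>The closure of a closable polynomial\<close>

context
  fixes p :: "'a::idempotent_semifield poly"
  assumes inf: "infinite (UNIV :: 'a set)" and closable: "closable p"
begin

lemma coeff_poly_closure_le: "v \<in> closure_values p j \<Longrightarrow> coeff (poly_closure p) j \<le> v"
  using isGlb_coeff_poly_closure[OF inf closable, of j] unfolding isGlb_UNIV_iff by blast

lemma coeff_poly_closure_greatest:
  "(\<And>v. v \<in> closure_values p j \<Longrightarrow> m \<le> v) \<Longrightarrow> m \<le> coeff (poly_closure p) j"
  using isGlb_coeff_poly_closure[OF inf closable, of j] unfolding isGlb_UNIV_iff by blast

lemma coeff_poly_closure_high: "degree p \<le> j \<Longrightarrow> coeff (poly_closure p) j = coeff p j"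
  using isGlb_coeff_poly_closure[OF inf closable] isGlb_closure_values_high[OF inf]
    isGlb_UNIV_unique by blast

lemma coeff_poly_closure_0: "coeff (poly_closure p) 0 = coeff p 0"
proof (rule isGlb_UNIV_unique[OF isGlb_coeff_poly_closure[OF inf closable]])
  show "isGlb UNIV (closure_values p 0) (coeff p 0)"
    by (rule isGlb_closure_values_low[OF inf]) simp
qed

lemma degree_poly_closure: "degree (poly_closure p) = degree p"
proof (cases "p = 0")
  case True
  then have "coeff (poly_closure p) j = 0" for j
    using coeff_poly_closure_high[of j] by simp
  then have "poly_closure p = 0" by (simp add: poly_eq_iff)
  with True show ?thesis by simp
next
  case False
  show ?thesis
  proof (rule antisym)
    show "degree (poly_closure p) \<le> degree p"
      by (rule degree_le) (simp add: coeff_poly_closure_high coeff_eq_0)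
    show "degree p \<le> degree (poly_closure p)"
      using False by (intro le_degree) (simp add: coeff_poly_closure_high)
  qed
qed

lemma coeff_poly_closure_power_le:
  assumes "x \<noteq> 0"
  shows "coeff (poly_closure p) j * x ^ j \<le> poly p x"
proof -
  have "coeff (poly_closure p) j * x ^ j \<le> poly p x * inverse x ^ j * x ^ j"
    using assms
    by (intro semifield_mult_mono coeff_poly_closure_le) (auto simp: closure_values_def)
  then show ?thesis
    using semifield_power_cancel(1)[OF assms, of j 0] by (simp add: mult.assoc)
qed

text \<open>For nonzero \<open>x\<close>, each monomial of the closure is at most
  \<open>poly p x\<close> and at least the corresponding monomial of \<open>p\<close>. The infima
  omit \<open>x = 0\<close>, where the unchanged constant coefficient decides.\<close>

lemma poly_poly_closure: "poly (poly_closure p) x = poly p x"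
proof (cases "x = 0")
  case True
  then show ?thesis by (simp add: poly_0_coeff_0 coeff_poly_closure_0)
next
  case False
  show ?thesis
  proof (rule antisym)
    show "poly (poly_closure p) x \<le> poly p x"
      using False unfolding poly_altdef[of "poly_closure p"]
      by (intro semifield_sum_least coeff_poly_closure_power_le) simp
    have "coeff p i * x ^ i \<le> poly (poly_closure p) x" for i
    proof -
      have "coeff p i * x ^ i \<le> coeff (poly_closure p) i * x ^ i"
        by (intro semifield_mult_mono coeff_poly_closure_greatest coeff_le_closure_values) auto
      also have "\<dots> \<le> poly (poly_closure p) x" by (rule coeff_power_le_poly)
      finally show ?thesis .
    qed
    then show "poly p x \<le> poly (poly_closure p) x"
      unfolding poly_altdef[of p] by (intro semifield_sum_least) simp
  qed
qed

text \<open>At a fixed \<open>x\<close>, the closure values at \<open>j\<close> and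
  \<open>j + 2\<close> multiply to the square of the one at \<open>j + 1\<close>;
  \<open>isGlb_square\<close> then passes to the infimum.\<close>

lemma coeff_poly_closure_concave:
  "coeff (poly_closure p) j * coeff (poly_closure p) (Suc (Suc j))
    \<le> coeff (poly_closure p) (Suc j) * coeff (poly_closure p) (Suc j)"
proof (rule isGlb_square[OF isGlb_coeff_poly_closure[OF inf closable] closure_values_nonempty])
  fix v assume "v \<in> closure_values p (Suc j)"
  then obtain x where x: "x \<noteq> 0" "v = poly p x * inverse x ^ Suc j"
    by (auto simp: closure_values_def)
  have "coeff (poly_closure p) j * coeff (poly_closure p) (Suc (Suc j))
    \<le> (poly p x * inverse x ^ j) * (poly p x * inverse x ^ Suc (Suc j))"
    using x(1) unfolding closure_values_def
    by (intro semifield_mult_mono coeff_poly_closure_le) (auto simp: closure_values_def)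
  also have "\<dots> = v * v" by (simp add: x(2) ac_simps)
  finally show "coeff (poly_closure p) j * coeff (poly_closure p) (Suc (Suc j)) \<le> v * v" .
qed

text \<open>Concavity alone allows gaps of two or more zero coefficients. Here the infimum
  \<open>b\<close> of the coefficient at \<open>j\<close> and the leading one is a nonzero lower
  bound at \<open>j + 1\<close>, since \<open>x ^ Suc j\<close> lies below
  \<open>x ^ j + x ^ degree p\<close>.\<close>

lemma coeff_poly_closure_nonzero_Suc:
  assumes j: "j < degree p" and nz: "coeff (poly_closure p) j \<noteq> 0"
  shows "coeff (poly_closure p) (Suc j) \<noteq> 0"
proof -
  let ?q = "poly_closure p"
  obtain d where d: "degree p = j + Suc d" using j less_imp_Suc_add by auto
  have lead: "coeff ?q (degree p) \<noteq> 0"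
    using j by (auto simp: coeff_poly_closure_high)
  obtain b where b: "b \<le> coeff ?q j" "b \<le> coeff ?q (degree p)"
    "(coeff ?q j + coeff ?q (degree p)) * b = coeff ?q j * coeff ?q (degree p)"
    by (rule semifield_meet)
  have b0: "b \<noteq> 0" using b(3) nz lead by auto
  have "b \<le> coeff ?q (Suc j)"
  proof (rule coeff_poly_closure_greatest)
    fix v assume "v \<in> closure_values p (Suc j)"
    then obtain x where x: "x \<noteq> 0" "v = poly p x * inverse x ^ Suc j"
      by (auto simp: closure_values_def)
    have "b * x ^ i \<le> poly p x" if "i \<in> {j, degree p}" for i
    proof -
      have "b * x ^ i \<le> coeff ?q i * x ^ i"
        using b that by (intro semifield_mult_mono) auto
      also have "\<dots> \<le> poly p x" by (rule coeff_poly_closure_power_le[OF x(1)])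
      finally show ?thesis .
    qed
    then have "b * x ^ j + b * x ^ degree p \<le> poly p x"
      by (intro semifield_add_least) auto
    moreover have "b * x ^ Suc j \<le> b * x ^ j + b * x ^ degree p"
      using semifield_mult_left_mono[OF le_one_add_power_Suc[of x d], of "b * x ^ j"]
      by (simp add: d power_add distrib_left ac_simps)
    ultimately have "b * x ^ Suc j \<le> poly p x" by (rule order_trans[rotated])
    then have "b * x ^ Suc j * inverse x ^ Suc j \<le> v"
      unfolding x(2) by (intro semifield_mult_mono) auto
    then show "b \<le> v"
      using semifield_power_cancel(1)[OF x(1), of "Suc j" 0]
      by (simp add: mult.assoc mult.commute[of "x ^ Suc j"] del: power_Suc)
  qed
  then show ?thesis using b0 semifield_le_zero[of b] by auto
qed

lemma poly_fun_splits_if_closable: "poly_fun_splits p"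
proof (cases "p = 0")
  case True
  then show ?thesis by (auto simp: poly_fun_splits_def)
next
  case False
  have "poly_closure p \<noteq> 0"
    using False coeff_poly_closure_high[of "degree p"] by auto
  then obtain cs where cs: "length cs = degree p"
    "poly_closure p = smult (coeff (poly_closure p) (degree p)) (\<Prod>c\<leftarrow>cs. [:c, 1:])"
    using linear_factorization[OF degree_poly_closure _ coeff_poly_closure_concave
        coeff_poly_closure_nonzero_Suc] by metis
  have "poly p x = coeff p (degree p) * (\<Prod>c\<leftarrow>cs. x + c)" for x
    using arg_cong[OF cs(2), of "\<lambda>q. poly q x"]
    by (simp add: poly_poly_closure poly_prod_list_linear coeff_poly_closure_high)
  with cs(1) show ?thesis unfolding poly_fun_splits_def by blast
qed

end

section \<open>From splitting to the closure and its corners\<close>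

text \<open>Closure values depend only on the polynomial function, so those of \<open>p\<close> are
  those of the sorted formal product \<open>q\<close>, whose coefficients are their infima.\<close>

lemma poly_closure_eq_if_splits:
  fixes p :: "'a::idempotent_semifield poly"
  assumes inf: "infinite (UNIV :: 'a set)" and splits: "poly_fun_splits p"
  obtains cs where "length cs = degree p" "sorted_wrt (\<ge>) cs" "closable p"
    "poly_closure p = smult (coeff p (degree p)) (\<Prod>c\<leftarrow>cs. [:c, 1:])"
    "\<And>x. poly p x = poly (poly_closure p) x"
proof -
  let ?a = "coeff p (degree p)"
  obtain rs where rs: "length rs = degree p" "\<And>x. poly p x = ?a * (\<Prod>r\<leftarrow>rs. x + r)"
    using splits unfolding poly_fun_splits_def by blast
  obtain cs where cs: "length cs = length rs" "sorted_wrt (\<ge>) cs"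
    "(\<Prod>c\<leftarrow>cs. [:c, 1:]) = (\<Prod>r\<leftarrow>rs. [:r, 1:])"
    by (rule sorted_linear_product)
  define q where "q = smult ?a (\<Prod>c\<leftarrow>cs. [:c, 1:])"
  have poly: "poly p x = poly q x" for x
    by (simp add: q_def cs(3) rs(2) poly_prod_list_linear)
  have glb: "isGlb UNIV (closure_values p j) (coeff q j)" for j
    using isGlb_closure_values_sorted_product[OF cs(2) inf, of ?a j]
    by (simp add: closure_values_def poly q_def)
  then have cl: "closable p" unfolding closable_def by blast
  have "poly_closure p = q"
    using isGlb_UNIV_unique[OF isGlb_coeff_poly_closure[OF inf cl] glb] by (rule poly_eqI)
  with that[of cs] rs(1) cs cl poly show ?thesis by (simp add: q_def)
qed

theorem theorem5p12:
  fixes p :: "'a::idempotent_semifield poly" and n :: nat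
  assumes "infinite (UNIV :: 'a set)"
    and "degree p = n" and "n > 0"
  shows "(closable p \<longleftrightarrow> poly_fun_splits p) \<and>
    (closable p \<longrightarrow>
       is_corners (poly_closure p) (corners (poly_closure p)) \<and>
       length (corners (poly_closure p)) = n \<and>
       (\<forall>x. poly p x = coeff p n * (\<Prod>k=1..n. x + corner (poly_closure p) k)) \<and>
       (\<forall>j<n.
          let c = corner (poly_closure p) (n - j) in
            coeff (poly_closure p) j ^ (j + 1) = poly p c * coeff (poly_closure p) (j + 1) ^ j \<and>
            (c \<noteq> 0 \<longrightarrow> coeff (poly_closure p) j = poly p c * inverse c ^ j)))"
proof (intro conjI impI)
  show "closable p \<longleftrightarrow> poly_fun_splits p"
    using poly_fun_splits_if_closable[OF assms(1)] poly_closure_eq_if_splits[OF assms(1)] by blast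
next
  let ?q = "poly_closure p"
  assume "closable p"
  \<comment> \<open>The detour through splitting yields a sorted formal factorization of the
    closure.\<close>
  then have "poly_fun_splits p" by (rule poly_fun_splits_if_closable[OF assms(1)])
  then obtain cs where cs: "length cs = n" "sorted_wrt (\<ge>) cs"
    and q: "?q = smult (coeff p n) (\<Prod>c\<leftarrow>cs. [:c, 1:])"
    and poly: "\<And>x. poly p x = poly ?q x"
    using poly_closure_eq_if_splits[OF assms(1)] assms(2) by metis
  have a: "coeff p n \<noteq> 0" using assms(2,3) by auto
  have deg: "degree ?q = n" using degree_sorted_product[OF cs(2) a] cs(1) q by simp
  have "coeff ?q n = coeff p n"
    using coeff_sorted_product[OF cs(2), of "coeff p n" n] cs(1) q by simp
  then have ic: "is_corners ?q cs" using q deg cs by (simp add: is_corners_def)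
  have "?q \<noteq> 0" using deg assms(3) by auto
  then have corners: "corners ?q = cs"
    unfolding corners_def using ic is_corners_unique by (intro the_equality) auto
  show "is_corners ?q (corners ?q)" "length (corners ?q) = n"
    using ic cs by (simp_all add: corners)
  have "(\<Prod>c\<leftarrow>cs. x + c) = (\<Prod>k=1..n. x + corner ?q k)" for x
  proof -
    have "(\<Prod>c\<leftarrow>cs. x + c) = (\<Prod>k<n. x + cs ! k)"
      using cs(1) by (simp add: prod.list_conv_set_nth atLeast0LessThan)
    also have "\<dots> = (\<Prod>k=1..n. x + corner ?q k)"
      by (rule prod.reindex_bij_witness[of _ "\<lambda>k. k - 1" Suc]) (auto simp: corner_def corners)
    finally show ?thesis .
  qed
  then show "\<forall>x. poly p x = coeff p n * (\<Prod>k=1..n. x + corner ?q k)"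
    using poly by (simp add: q poly_prod_list_linear)
  show "\<forall>j<n. let c = corner ?q (n - j) in
      coeff ?q j ^ (j + 1) = poly p c * coeff ?q (j + 1) ^ j \<and>
      (c \<noteq> 0 \<longrightarrow> coeff ?q j = poly p c * inverse c ^ j)"
  proof (intro allI impI)
    fix j assume j: "j < n"
    define c where "c = corner ?q (n - j)"
    have c: "c = cs ! (length cs - Suc j)"
      using j cs(1) by (simp add: c_def corner_def corners)
    have eval: "poly p c = coeff ?q j * c ^ j"
      using poly_sorted_product[OF cs(2), of j "coeff p n"] j cs(1) c q poly by simp
    have Suc: "coeff ?q j = coeff ?q (j + 1) * c"
      using coeff_sorted_product_Suc[OF cs(2), of j "coeff p n"] j cs(1) c q by simp
    \<comment> \<open>Only \<open>j\<close> of the \<open>j + 1\<close> factors are rewritten; the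
      remaining one joins \<open>c ^ j\<close> to form \<open>poly p c\<close>. Nothing is divided,
      so \<open>c = 0\<close> is included.\<close>
    have "coeff ?q j ^ (j + 1) = coeff ?q j * (coeff ?q (j + 1) * c) ^ j"
      using Suc by simp
    also have "\<dots> = poly p c * coeff ?q (j + 1) ^ j"
      by (simp add: eval power_mult_distrib ac_simps)
    finally have "coeff ?q j ^ (j + 1) = poly p c * coeff ?q (j + 1) ^ j" .
    moreover have "coeff ?q j = poly p c * inverse c ^ j" if "c \<noteq> 0"
      using semifield_power_cancel(1)[OF that, of j 0]
      by (simp add: eval mult.assoc mult.commute[of "c ^ j"])
    ultimately show "let c = corner ?q (n - j) in
        coeff ?q j ^ (j + 1) = poly p c * coeff ?q (j + 1) ^ j \<and>
        (c \<noteq> 0 \<longrightarrow> coeff ?q j = poly p c * inverse c ^ j)"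
      by (simp add: c_def Let_def)
  qed
qed

end
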